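(* Let $X$ be a subgaussian random variable with a symmetric distribution (about zero), and let $f(z)=\mathbb{E}\,e^{izX}$, $z\in\mathbb{C}$. If all zeros $z$ of $f$ with $\mathrm{Re}(z)\ge 0$ lie in the angle $|\mathrm{Arg}(z)|\le\frac{\pi}{8}$, then $X$ is strictly subgaussian. Moreover, if $X$ is not normal, then for any $t_0>0$ there exists $c=c(t_0)$, $0<c<\sigma^2=\mathrm{Var}(X)$, such that $$\mathbb{E}\,e^{tX}\le e^{ct^2/2},\qquad |t|\ge t_0.$$
   Context: A random variable $X$ is called subgaussian if $\mathbb{E}\,e^{cX^2}<\infty$ for some constant $c>0$; then its characteristic function extends from the real line to an entire function $f(z)=\mathbb{E}\,e^{izX}$ on $\mathbb{C}$. $X$ is called strictly subgaussian if $\mathbb{E}\,e^{tX}\le e^{\sigma^2t^2/2}$ for all $t\in\mathbb{R}$ with $\sigma^2=\mathrm{Var}(X)$. $\mathrm{Arg}$ is the principal argument, with values in $(-\pi,\pi]$. The point mass at $0$ is regarded as a (degenerate) normal distribution. *)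

theory Defs
  imports "HOL-Probability.Probability"
begin

definition subgaussian :: "'a measure \<Rightarrow> ('a \<Rightarrow> real) \<Rightarrow> bool" where
  "subgaussian M X \<longleftrightarrow> (\<exists>c>0. integrable M (\<lambda>\<omega>. exp (c * (X \<omega>)\<^sup>2)))"

(* The integrability conjunct expresses that the Laplace transform is finite; it is needed because
   the Bochner integral of a non-integrable function is 0 by convention. *)
definition strictly_subgaussian :: "'a measure \<Rightarrow> ('a \<Rightarrow> real) \<Rightarrow> bool" where
  "strictly_subgaussian M X \<longleftrightarrow>
     (\<forall>t. integrable M (\<lambda>\<omega>. exp (t * X \<omega>)) \<and>
          prob_space.expectation M (\<lambda>\<omega>. exp (t * X \<omega>))
            \<le> exp (prob_space.variance M X * t\<^sup>2 / 2))"

definition symmetric_distribution :: "'a measure \<Rightarrow> ('a \<Rightarrow> real) \<Rightarrow> bool" where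
  "symmetric_distribution M X \<longleftrightarrow> distr M borel X = distr M borel (\<lambda>\<omega>. - X \<omega>)"

(* The extension to the complex plane of the characteristic function of X; the integral exists for
   every z when X is subgaussian. *)
definition complex_char :: "'a measure \<Rightarrow> ('a \<Rightarrow> real) \<Rightarrow> complex \<Rightarrow> complex" where
  "complex_char M X z = (CLINT \<omega>|M. exp (\<i> * z * complex_of_real (X \<omega>)))"

(* The second disjunct admits the point mass at 0 as a degenerate normal distribution. *)
definition normal_rv :: "'a measure \<Rightarrow> ('a \<Rightarrow> real) \<Rightarrow> bool" where
  "normal_rv M X \<longleftrightarrow>
     (\<exists>\<mu> s. s > 0 \<and> distributed M lborel X (\<lambda>x. ennreal (normal_density \<mu> s x))) \<or>
     distr M borel X = return borel 0"

end

theory Submission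
  imports Defs "HOL-Complex_Analysis.Complex_Analysis" "HOL-Real_Asymp.Real_Asymp"
begin

text \<open>
  Let \<open>v\<close> be the variance of \<open>X\<close>. The function \<open>f(z) = E exp(\<i> z X)\<close> is entire, even by symmetry, of
  growth \<open>exp(O(|z|\<^sup>2))\<close>, with \<open>f(0) = 1\<close> and \<open>f''(0) = - v\<close>; moreover \<open>f(\<i> t) = E exp(t X)\<close>. A
  factorisation over the zeros \<open>a\<close> of \<open>f\<close>, of the Hadamard type, reads

  \<open>f(z)\<^sup>2 = exp(- v z\<^sup>2) \<cdot> \<Prod>a. (1 - (z/a)\<^sup>2) exp((z/a)\<^sup>2)\<close>,

  and at \<open>z = \<i> t\<close> each factor is \<open>(1 + u) exp(- u)\<close> with \<open>u = t\<^sup>2 / a\<^sup>2\<close>. Since the zeros, up to sign,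
  lie in the angle of half-opening \<open>pi / 8\<close>, the numbers \<open>u\<close> lie in the sector \<open>|Im u| \<le> Re u\<close>. There
  \<open>|1 + u|\<^sup>2 \<le> 1 + 2 Re u + 2 (Re u)\<^sup>2 \<le> exp(2 Re u)\<close>, so every factor has modulus at most \<open>1\<close>
  and \<open>(E exp(t X))\<^sup>2 \<le> exp(v t\<^sup>2)\<close>. This is strict subgaussianity.

  If there are no zeros, then \<open>f(z)\<^sup>2 = exp(- v z\<^sup>2)\<close> and \<open>X\<close> is normal by the uniqueness theorem for
  characteristic functions. So a non-normal \<open>X\<close> has a zero \<open>b\<close>, and keeping its factor in
  the estimate gains \<open>exp(- \<delta> t\<^sup>2 Re (1/b\<^sup>2))\<close> for all \<open>|t| \<ge> t0\<close>, where \<open>\<delta> > 0\<close> depends on \<open>t0\<close>.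

  The infinite product is never formed. For each radius \<open>R\<close> one splits off only the zeros in the
  disc of radius \<open>R\<close>; the even part of the logarithm of the remaining factor is, up
  to an error \<open>O(|z|\<^sup>3 / R)\<close>, a multiple of \<open>z\<^sup>2\<close> determined by \<open>f''(0)\<close> and the removed zeros
  (lemma \<open>even_entire_quadratic_factorization\<close>). The estimates above hold for the finite products
  uniformly in \<open>R\<close>, and \<open>R\<close> tends to infinity at the end.
\<close>

section \<open>Removing the zeros of an entire function in a disc\<close>

text \<open>
  The local factorisation at the zero extends to the whole plane, because away from
  \<open>a\<close> the quotient is visibly holomorphic. The factor is normalised to \<open>1 - w / a\<close>
  rather than \<open>w - a\<close>, so that it does not change the value at the origin.
\<close>
lemma divide_out_zero:
  fixes f :: "complex \<Rightarrow> complex"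
  assumes f: "f holomorphic_on UNIV" and f0: "f 0 \<noteq> 0" and a: "f a = 0"
  obtains n g where "n > 0" "g holomorphic_on UNIV" "g a \<noteq> 0" "\<And>w. f w = (1 - w / a) ^ n * g w"
proof -
  have "a \<noteq> 0" using f0 a by auto
  define n where "n = nat (zorder f a)"
  have "(if f a = 0 then zorder f a > 0 else zorder f a = 0) \<and>
    (\<exists>r. r > 0 \<and> cball a r \<subseteq> UNIV \<and> zor_poly f a holomorphic_on cball a r
      \<and> (\<forall>w\<in>cball a r. f w = zor_poly f a w * (w - a) ^ nat (zorder f a) \<and> zor_poly f a w \<noteq> 0))"
    by (rule zorder_exist_zero) (use f f0 in auto)
  then obtain r h where n: "n > 0" and r: "r > 0" and h: "h holomorphic_on cball a r"
    and fh: "\<And>w. w \<in> cball a r \<Longrightarrow> f w = h w * (w - a) ^ n \<and> h w \<noteq> 0"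
    using a by (auto simp: n_def)
  define g where "g w = (if w = a then (- a) ^ n * h a else f w / (1 - w / a) ^ n)" for w
  have lin: "1 - w / a = (w - a) / (- a)" for w
    using \<open>a \<noteq> 0\<close> by (simp add: field_simps)
  have g_near: "g w = (- a) ^ n * h w" if "w \<in> cball a r" for w
    using fh[OF that] \<open>a \<noteq> 0\<close> by (auto simp: g_def lin power_divide simp del: divide_minus_right)
  have "g holomorphic_on ball a r \<union> (- {a})"
  proof (rule holomorphic_on_Un)
    have "(\<lambda>w. (- a) ^ n * h w) holomorphic_on ball a r"
      by (intro holomorphic_intros holomorphic_on_subset[OF h]) auto
    then show "g holomorphic_on ball a r"
      by (rule holomorphic_transform) (auto simp: g_near)
    have "(\<lambda>w. f w / (1 - w / a) ^ n) holomorphic_on - {a}"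
      using \<open>a \<noteq> 0\<close> by (intro holomorphic_intros holomorphic_on_subset[OF f]) (auto simp: field_simps)
    then show "g holomorphic_on - {a}"
      by (rule holomorphic_transform) (auto simp: g_def)
  qed auto
  moreover have "ball a r \<union> (- {a}) = UNIV" using r by auto
  ultimately have "g holomorphic_on UNIV" by simp
  moreover have "g a \<noteq> 0"
    using g_near[of a] fh[of a] r \<open>a \<noteq> 0\<close> by auto
  moreover have "f w = (1 - w / a) ^ n * g w" for w
    using \<open>a \<noteq> 0\<close> a n by (auto simp: g_def)
  ultimately show ?thesis using n that by blast
qed

lemma finite_zeros_in_cball:
  fixes f :: "complex \<Rightarrow> complex"
  assumes f: "f holomorphic_on UNIV" and f0: "f 0 \<noteq> 0"
  shows "finite {z \<in> cball 0 R. f z = 0}"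
proof (cases "f constant_on UNIV")
  case True
  then obtain y where "\<And>z. f z = y" by (auto simp: constant_on_def)
  with f0 show ?thesis by simp
next
  case False
  then show ?thesis
    using holomorphic_compact_finite_zeros[of f UNIV "cball 0 R"] f by auto
qed

text \<open>
  The list repeats each zero according to its multiplicity. Induction on the number of distinct
  zeros in the disc: dividing out one of them, with its full multiplicity, removes it and creates
  no other.
\<close>
lemma zero_factorization:
  fixes f :: "complex \<Rightarrow> complex"
  assumes "f holomorphic_on UNIV" and "f 0 \<noteq> 0"
  shows "\<exists>zs g. g holomorphic_on UNIV \<and> (\<forall>z\<in>cball 0 R. g z \<noteq> 0) \<and>
      set zs = {a \<in> cball 0 R. f a = 0} \<and> (\<forall>z. f z = (\<Prod>a\<leftarrow>zs. 1 - z / a) * g z)"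
  using assms
proof (induction "card {a \<in> cball 0 R. f a = 0}" arbitrary: f rule: less_induct)
  case less
  show ?case
  proof (cases "{a \<in> cball 0 R. f a = 0} = {}")
    case True
    then show ?thesis
      using less.prems by (intro exI[of _ "[]"] exI[of _ f]) auto
  next
    case False
    then obtain b where b: "b \<in> cball 0 R" "f b = 0" by auto
    obtain n g where n: "n > 0" and g: "g holomorphic_on UNIV" "g b \<noteq> 0"
      and fg: "\<And>w. f w = (1 - w / b) ^ n * g w"
      using divide_out_zero[OF less.prems b(2)] by blast
    have "b \<noteq> 0" using b less.prems by auto
    have g0: "g 0 \<noteq> 0" using fg[of 0] less.prems(2) by auto
    have zeros: "{a \<in> cball 0 R. f a = 0} = insert b {a \<in> cball 0 R. g a = 0}"
      using b \<open>b \<noteq> 0\<close> n by (auto simp: fg)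
    have "card {a \<in> cball 0 R. g a = 0} < card {a \<in> cball 0 R. f a = 0}"
      using g(2) finite_zeros_in_cball[OF g(1) g0, of R] unfolding zeros by (subst card_insert_disjoint) auto
    from less.hyps[OF this g(1) g0] obtain zs h where
      h: "h holomorphic_on UNIV" "\<forall>z\<in>cball 0 R. h z \<noteq> 0"
      and zs: "set zs = {a \<in> cball 0 R. g a = 0}" "\<forall>z. g z = (\<Prod>a\<leftarrow>zs. 1 - z / a) * h z"
      by blast
    show ?thesis
      using h zs n zeros
      by (intro exI[of _ "replicate n b @ zs"] exI[of _ h])
        (auto simp: fg set_replicate_conv_if prod_list_replicate)
  qed
qed

lemma norm_prod_list_ge_1:
  fixes h :: "'a \<Rightarrow> complex"
  assumes "\<And>a. a \<in> set zs \<Longrightarrow> 1 \<le> norm (h a)"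
  shows "1 \<le> norm (\<Prod>a\<leftarrow>zs. h a)"
  using assms
proof (induction zs)
  case (Cons a zs)
  then have "1 * 1 \<le> norm (h a) * norm (\<Prod>a\<leftarrow>zs. h a)"
    by (intro mult_mono) auto
  then show ?case by (simp add: norm_mult)
qed auto

text \<open>
  On the circle of radius \<open>2 * R\<close> each factor satisfies \<open>norm (1 - z / a) \<ge> 2 - 1\<close>, so
  dividing by the product does not increase the modulus there; the maximum principle carries the
  bound inside.
\<close>
lemma norm_cofactor_le:
  fixes f g :: "complex \<Rightarrow> complex"
  assumes g: "g holomorphic_on UNIV" and R: "R > 0"
    and zs: "\<And>a. a \<in> set zs \<Longrightarrow> a \<noteq> 0 \<and> norm a \<le> R"
    and fg: "\<And>z. f z = (\<Prod>a\<leftarrow>zs. 1 - z / a) * g z"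
    and bound: "\<And>z. norm z = 2 * R \<Longrightarrow> norm (f z) \<le> B"
    and z: "norm z \<le> 2 * R"
  shows "norm (g z) \<le> B"
proof (rule maximum_modulus_frontier[of g "cball 0 (2 * R)"])
  show "g holomorphic_on interior (cball 0 (2 * R))" "continuous_on (closure (cball 0 (2 * R))) g"
    using g by (auto intro: holomorphic_on_subset holomorphic_on_imp_continuous_on)
  fix w :: complex assume "w \<in> frontier (cball 0 (2 * R))"
  then have w: "norm w = 2 * R" using R by (simp add: frontier_cball)
  have "1 \<le> norm (1 - w / a)" if "a \<in> set zs" for a
  proof -
    have "2 \<le> norm (w / a)"
      using zs[OF that] w by (simp add: norm_divide field_simps)
    then show ?thesis
      using norm_triangle_ineq2[of "w / a" 1] by (simp add: norm_minus_commute)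
  qed
  then have "1 \<le> norm (\<Prod>a\<leftarrow>zs. 1 - w / a)"
    by (rule norm_prod_list_ge_1)
  then have "1 * norm (g w) \<le> norm (\<Prod>a\<leftarrow>zs. 1 - w / a) * norm (g w)"
    by (intro mult_right_mono) auto
  also have "\<dots> = norm (f w)" by (simp add: fg norm_mult)
  finally show "norm (g w) \<le> B" using bound[OF w] by simp
qed (use z in auto)

section \<open>Growth of a logarithm and second derivatives at the origin\<close>

text \<open>
  Borel--Caratheodory inequality on the disc of half the radius. The function
  \<open>G / (2 * M - G)\<close> maps the disc into the unit disc, since \<open>G z\<close> is closer to \<open>0\<close> than to
  \<open>2 * M\<close> when \<open>Re (G z) < M\<close>, and Schwarz's lemma bounds it by \<open>1 / 2\<close> there.
\<close>
lemma Borel_Caratheodory_half: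
  fixes G :: "complex \<Rightarrow> complex"
  assumes G: "G holomorphic_on ball 0 R" and G0: "G 0 = 0"
    and Re: "\<And>z. z \<in> ball 0 R \<Longrightarrow> Re (G z) < M" and z: "norm z \<le> R / 2" and R: "R > 0"
  shows "norm (G z) \<le> 2 * M"
proof -
  have M: "M > 0" using Re[of 0] G0 R by simp
  have less: "norm (G w) < norm (2 * M - G w)" if "w \<in> ball 0 R" for w
  proof -
    have "(norm (2 * M - G w))\<^sup>2 - (norm (G w))\<^sup>2 = 4 * M * (M - Re (G w))"
      by (simp only: cmod_power2) (simp add: power2_eq_square algebra_simps)
    also have "\<dots> > 0" using M Re[OF that] by simp
    finally have "(norm (G w))\<^sup>2 < (norm (2 * M - G w))\<^sup>2" by simp
    then show ?thesis by (rule power_less_imp_less_base) auto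
  qed
  define \<phi> where "\<phi> w = G (R * w) / (2 * M - G (R * w))" for w :: complex
  have in_ball: "R * w \<in> ball 0 R" if "norm w < 1" for w :: complex
    using that R by (simp add: norm_mult)
  have nz: "2 * M - G (R * w) \<noteq> 0" if "norm w < 1" for w :: complex
    using less[OF in_ball[OF that]] by auto
  have comp: "(\<lambda>w. G (R * w)) holomorphic_on ball 0 1"
  proof -
    have "(G \<circ> (\<lambda>w. R * w)) holomorphic_on ball 0 1"
      using in_ball by (intro holomorphic_on_compose_gen[OF _ G] holomorphic_intros) auto
    then show ?thesis by (simp add: o_def)
  qed
  have "norm (\<phi> (z / R)) \<le> norm (z / R)"
  proof (rule Schwarz_Lemma(1))
    show "\<phi> holomorphic_on ball 0 1"
      unfolding \<phi>_def using nz by (intro holomorphic_intros comp) auto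
    show "\<phi> 0 = 0" by (simp add: \<phi>_def G0)
    show "norm (\<phi> w) < 1" if "norm w < 1" for w :: complex
      using less[OF in_ball[OF that]] nz[OF that] by (simp add: \<phi>_def norm_divide divide_simps)
    show "norm (z / R) < 1" using z R by (simp add: norm_divide)
  qed
  also have "\<dots> \<le> 1 / 2" using z R by (simp add: norm_divide field_simps)
  finally have "norm (G z / (2 * M - G z)) \<le> 1 / 2" using R by (simp add: \<phi>_def)
  moreover have "norm (2 * M - G z) > 0"
  proof -
    have "z \<in> ball 0 R" using z R by simp
    then show ?thesis using less[of z] norm_ge_zero[of "G z"] by linarith
  qed
  ultimately have "2 * norm (G z) \<le> norm (2 * M - G z)"
    by (simp add: norm_divide field_simps)
  also have "\<dots> \<le> 2 * M + norm (G z)"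
    using norm_triangle_ineq4[of "complex_of_real (2 * M)" "G z"] M by (simp add: norm_mult)
  finally show ?thesis by simp
qed

text \<open>
  Cauchy's estimate on discs of radius \<open>r / 2\<close> controls the third derivative by
  \<open>3! * B / (r / 2) ^ 3\<close>. What matters later is the decay in \<open>r\<close>: a bound \<open>B\<close> of order \<open>r\<^sup>2\<close>
  leaves a remainder of order \<open>1 / r\<close> at a fixed point.
\<close>
lemma Taylor_quadratic_remainder:
  fixes G :: "complex \<Rightarrow> complex"
  assumes G: "G holomorphic_on S" "open S" "cball 0 r \<subseteq> S"
    and B: "\<And>z. norm z \<le> r \<Longrightarrow> norm (G z) \<le> B" and r: "r > 0" and z: "norm z \<le> r / 2"
  shows "norm (G z - (G 0 + deriv G 0 * z + (deriv ^^ 2) G 0 * z\<^sup>2 / 2)) \<le> 24 * B / r ^ 3 * norm z ^ 3"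
proof -
  have "cmod ((deriv ^^ 0) G z - (\<Sum>i\<le>2. (deriv ^^ i) G 0 * (z - 0) ^ i / fact i))
      \<le> 48 * B / r ^ 3 * cmod (z - 0) ^ Suc 2 / fact 2"
  proof (rule complex_Taylor[of "cball 0 (r / 2)"])
    fix i :: nat and x :: complex assume "x \<in> cball 0 (r / 2)"
    then have "x \<in> S" using G(3) r by (auto simp: subset_iff)
    then show "((deriv ^^ i) G has_field_derivative (deriv ^^ Suc i) G x) (at x within cball 0 (r / 2))"
      using has_field_derivative_higher_deriv[OF G(1,2)] DERIV_subset by fastforce
  next
    fix x :: complex assume x: "x \<in> cball 0 (r / 2)"
    have sub: "cball x (r / 2) \<subseteq> cball 0 r"
      using x by (auto simp: cball_subset_cball_iff)
    have "cmod ((deriv ^^ 3) G x) \<le> fact 3 * B / (r / 2) ^ 3"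
    proof (rule Cauchy_inequality)
      have "G holomorphic_on cball x (r / 2)"
        using G sub holomorphic_on_subset by (metis subset_trans)
      then show "G holomorphic_on ball x (r / 2)" "continuous_on (cball x (r / 2)) G"
        by (auto intro: holomorphic_on_imp_continuous_on elim: holomorphic_on_subset)
      show "cmod (G y) \<le> B" if "cmod (x - y) = r / 2" for y
        using that sub by (intro B) (auto simp: subset_iff dist_norm)
    qed (use r in auto)
    also have "\<dots> = 48 * B / r ^ 3" by (simp add: fact_numeral field_simps power_divide)
    finally show "cmod ((deriv ^^ Suc 2) G x) \<le> 48 * B / r ^ 3" by (simp add: numeral_3_eq_3 numeral_2_eq_2)
  qed (use z r in auto)
  then show ?thesis by (simp add: numeral_2_eq_2 numeral_3_eq_3 algebra_simps)
qed

lemma even_imp_deriv_0_eq_0: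
  fixes f :: "complex \<Rightarrow> complex"
  assumes f: "f holomorphic_on ball 0 r" and r: "r > 0" and even: "\<And>z. z \<in> ball 0 r \<Longrightarrow> f (- z) = f z"
  shows "deriv f 0 = 0"
proof -
  have D: "(f has_field_derivative deriv f 0) (at 0)"
    using f r by (intro holomorphic_derivI[OF f]) auto
  then have "((\<lambda>z. f (- z)) has_field_derivative deriv f 0 * (- 1)) (at 0)"
    by (intro DERIV_chain2[of f _ uminus]) (auto intro!: derivative_eq_intros)
  then have "(f has_field_derivative deriv f 0 * (- 1)) (at 0)"
    by (rule has_field_derivative_transform_within_open[of _ _ _ "ball 0 r"]) (use even r in auto)
  from DERIV_unique[OF D this] show ?thesis by simp
qed

text \<open>
  For functions with value \<open>1\<close> at the origin, one of which is critical there, the second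
  derivative turns products into sums like a logarithm. This allows the quadratic
  coefficients of the factors of an even function to be compared without choosing logarithms.
\<close>
lemma deriv2_mult_normalized:
  fixes f g :: "complex \<Rightarrow> complex"
  assumes "f holomorphic_on S" "g holomorphic_on S" "open S" "0 \<in> S"
    and "f 0 = 1" "g 0 = 1" "deriv f 0 = 0"
  shows "(deriv ^^ 2) (\<lambda>z. f z * g z) 0 = (deriv ^^ 2) f 0 + (deriv ^^ 2) g 0"
  using assms by (subst higher_deriv_mult[of f S g]) (auto simp: numeral_2_eq_2)

lemma deriv2_even_product:
  fixes zs :: "complex list"
  shows "(deriv ^^ 2) (\<lambda>z. \<Prod>a\<leftarrow>zs. 1 - (z / a)\<^sup>2) 0 = - 2 * (\<Sum>a\<leftarrow>zs. 1 / a\<^sup>2)"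
proof (induction zs)
  case (Cons a zs)
  have D: "deriv (\<lambda>z. 1 - (z / a)\<^sup>2) = (\<lambda>z. - 2 * z / a\<^sup>2)"
    by (rule ext, rule DERIV_imp_deriv, cases "a = 0") (auto intro!: derivative_eq_intros simp: power2_eq_square)
  have D2: "(deriv ^^ 2) (\<lambda>z. 1 - (z / a)\<^sup>2) 0 = - 2 / a\<^sup>2"
    unfolding numeral_2_eq_2 funpow.simps o_apply id_apply D[unfolded numeral_2_eq_2]
    by (rule DERIV_imp_deriv, cases "a = 0") (auto intro!: derivative_eq_intros)
  have hol: "(\<lambda>z. \<Prod>a\<leftarrow>zs. 1 - (z / a)\<^sup>2) holomorphic_on UNIV" for zs :: "complex list"
    by (induction zs) (auto intro!: holomorphic_intros)
  have one: "(\<Prod>a\<leftarrow>zs. 1 - (0 / a)\<^sup>2) = (1::complex)" for zs :: "complex list"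
    by (induction zs) auto
  have "(deriv ^^ 2) (\<lambda>z. (1 - (z / a)\<^sup>2) * (\<Prod>a\<leftarrow>zs. 1 - (z / a)\<^sup>2)) 0
     = (deriv ^^ 2) (\<lambda>z. 1 - (z / a)\<^sup>2) 0 + (deriv ^^ 2) (\<lambda>z. \<Prod>a\<leftarrow>zs. 1 - (z / a)\<^sup>2) 0"
    by (rule deriv2_mult_normalized[of _ UNIV])
      (use hol[of "[a]"] hol[of zs] one[of zs] in \<open>auto simp: D\<close>)
  then show ?case by (simp add: D2 Cons.IH)
qed auto

lemma deriv2_exp_comp:
  fixes G :: "complex \<Rightarrow> complex"
  assumes G: "G holomorphic_on S" "open S" "0 \<in> S" "G 0 = 0" "deriv G 0 = 0"
  shows "deriv (\<lambda>z. exp (G z)) 0 = 0" and "(deriv ^^ 2) (\<lambda>z. exp (G z)) 0 = (deriv ^^ 2) G 0"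
proof -
  have D: "deriv (\<lambda>z. exp (G z)) z = exp (G z) * deriv G z" if "z \<in> S" for z
    using holomorphic_derivI[OF G(1,2) that]
    by (intro DERIV_imp_deriv) (auto intro!: derivative_eq_intros)
  then show "deriv (\<lambda>z. exp (G z)) 0 = 0" using G by simp
  have "(deriv ^^ 2) (\<lambda>z. exp (G z)) 0 = deriv (deriv (\<lambda>z. exp (G z))) 0"
    by (simp add: numeral_2_eq_2)
  also have "\<dots> = deriv (\<lambda>z. exp (G z) * deriv G z) 0"
    by (rule complex_derivative_transform_within_open[of _ S])
      (use G in \<open>auto intro!: holomorphic_intros simp: D\<close>)
  also have "\<dots> = deriv (deriv G) 0"
  proof (rule DERIV_imp_deriv)
    have "(deriv G has_field_derivative deriv (deriv G) 0) (at 0)"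
      using G by (intro holomorphic_derivI[of _ S] holomorphic_deriv) auto
    moreover have "(G has_field_derivative 0) (at 0)"
      using holomorphic_derivI[OF G(1,2,3)] G(5) by simp
    ultimately show "((\<lambda>z. exp (G z) * deriv G z) has_field_derivative deriv (deriv G) 0) (at 0)"
      using G by (auto intro!: derivative_eq_intros)
  qed
  finally show "(deriv ^^ 2) (\<lambda>z. exp (G z)) 0 = (deriv ^^ 2) G 0" by (simp add: numeral_2_eq_2)
qed


section \<open>Even entire functions of order two\<close>

text \<open>
  A finite substitute for Hadamard's factorisation of a function of order two. With
  \<open>f = P * g\<close>, where \<open>P\<close> collects the zeros in the disc of radius \<open>R\<close>, a logarithm \<open>L\<close> of the
  cofactor \<open>g\<close> has real part \<open>O(R\<^sup>2)\<close>, and \<open>f(z)\<^sup>2 = f(z) f(-z)\<close> involves only the even function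
  \<open>G(z) = L(z) + L(-z)\<close>. By Borel--Caratheodory and Taylor, \<open>G\<close> is its quadratic term up to
  \<open>O(1 / R)\<close>. Comparing second derivatives at the origin shows that this quadratic term is
  \<open>f''(0) z\<^sup>2\<close> plus the sum of the \<open>(z / a)\<^sup>2\<close>, and the latter is distributed over the factors of
  the product. The bound on the error does not depend on the zeros, so \<open>R\<close> may tend to
  infinity without any discussion of the convergence of an infinite product.
\<close>
lemma even_entire_quadratic_factorization:
  fixes f :: "complex \<Rightarrow> complex"
  assumes f: "f holomorphic_on UNIV" and even: "\<And>z. f (- z) = f z" and f0: "f 0 = 1"
    and growth: "\<And>z. norm (f z) \<le> exp (A * (1 + (norm z)\<^sup>2))" and A: "A > 0" and R: "R \<ge> 1"
  obtains zs where "set zs = {a \<in> cball 0 R. f a = 0}"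
    "\<And>z. 4 * norm z \<le> R \<Longrightarrow> \<exists>e. norm e \<le> 4224 * A * norm z ^ 3 / R \<and>
       (f z)\<^sup>2 = (\<Prod>a\<leftarrow>zs. (1 - (z / a)\<^sup>2) * exp ((z / a)\<^sup>2)) * exp ((deriv ^^ 2) f 0 * z\<^sup>2 + e)"
proof -
  have f0': "f 0 \<noteq> 0" by (simp add: f0)
  obtain zs g where g: "g holomorphic_on UNIV" "\<forall>z\<in>cball 0 R. g z \<noteq> 0"
    and zs: "set zs = {a \<in> cball 0 R. f a = 0}" and fg': "\<forall>z. f z = (\<Prod>a\<leftarrow>zs. 1 - z / a) * g z"
    using zero_factorization[OF f f0', of R] by blast
  note fg = spec[OF fg']
  have g0: "g 0 = 1"
  proof -
    have "(\<Prod>a\<leftarrow>zs. 1 - 0 / a) = (1::complex)" by (induction zs) auto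
    then show ?thesis using fg[of 0] f0 by simp
  qed
  have g_le: "norm (g z) \<le> exp (5 * A * R\<^sup>2)" if "norm z \<le> 2 * R" for z
  proof (rule norm_cofactor_le[OF g(1) _ _ fg _ that])
    show "R > 0" using R by simp
    show "a \<noteq> 0 \<and> norm a \<le> R" if "a \<in> set zs" for a using that f0 zs by auto
    show "norm (f w) \<le> exp (5 * A * R\<^sup>2)" if w: "norm w = 2 * R" for w
    proof -
      have "1 \<le> R\<^sup>2" using R by (simp add: one_le_power)
      then have "A * (1 + (norm w)\<^sup>2) \<le> 5 * A * R\<^sup>2" using A by (simp add: w power_mult_distrib)
      then show ?thesis using growth[of w] by (meson exp_le_cancel_iff order_trans)
    qed
  qed
  obtain L0 where L0: "L0 holomorphic_on ball 0 R" "\<And>z. z \<in> ball 0 R \<Longrightarrow> g z = exp (L0 z)"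
    using contractible_imp_holomorphic_log[of g "ball 0 R"] g
    by (metis UNIV_I ball_subset_cball convex_ball convex_imp_contractible holomorphic_on_subset subsetD subset_UNIV)
  define L where "L z = L0 z - L0 0" for z
  have L: "L holomorphic_on ball 0 R" unfolding L_def by (intro holomorphic_intros L0)
  have L_0: "L 0 = 0" by (simp add: L_def)
  have gL: "g z = exp (L z)" if "z \<in> ball 0 R" for z
    using L0(2)[OF that] L0(2)[of 0] g0 R by (simp add: L_def exp_diff)
  define G where "G z = L z + L (- z)" for z
  have "(L \<circ> uminus) holomorphic_on ball 0 R"
    by (rule holomorphic_on_compose_gen[OF _ L]) (auto intro!: holomorphic_intros)
  then have G: "G holomorphic_on ball 0 R"
    unfolding G_def by (intro holomorphic_intros L) (simp add: o_def)
  have G0: "G 0 = 0" by (simp add: G_def L_0)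
  have Re_L: "Re (L z) \<le> 5 * A * R\<^sup>2" if "z \<in> ball 0 R" for z
    using g_le[of z] that R by (simp add: gL)
  \<comment> \<open>Twice \<open>5 * A * R\<^sup>2\<close>, enlarged so that the inequality is strict as Borel--Caratheodory requires.\<close>
  have Re_G: "Re (G z) < 11 * A * R\<^sup>2" if "z \<in> ball 0 R" for z
  proof -
    have "0 < A * R\<^sup>2" using A R by simp
    then show ?thesis using Re_L[of z] Re_L[of "- z"] that by (simp add: G_def)
  qed
  have G_le: "norm (G z) \<le> 2 * (11 * A * R\<^sup>2)" if "norm z \<le> R / 2" for z
    by (rule Borel_Caratheodory_half[OF G G0 Re_G that]) (use R in auto)
  have dG: "deriv G 0 = 0"
    by (rule even_imp_deriv_0_eq_0[OF G]) (use R in \<open>auto simp: G_def add.commute\<close>)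
  have df: "deriv f 0 = 0"
    by (rule even_imp_deriv_0_eq_0[of _ 1]) (use f even in \<open>auto intro: holomorphic_on_subset\<close>)
  define Q where "Q z = (\<Prod>a\<leftarrow>zs. 1 - (z / a)\<^sup>2)" for z
  have Q: "Q holomorphic_on UNIV"
    unfolding Q_def by (induction zs) (auto intro!: holomorphic_intros)
  have Q0: "Q 0 = 1" unfolding Q_def by (induction zs) auto
  have Q_eq: "Q z = (\<Prod>a\<leftarrow>zs. 1 - z / a) * (\<Prod>a\<leftarrow>zs. 1 - (- z) / a)" for z
    unfolding Q_def by (induction zs) (auto simp: algebra_simps power2_eq_square)
  have sq: "f z * f z = Q z * exp (G z)" if "z \<in> ball 0 R" for z
  proof -
    have "f z * f z = f z * f (- z)" by (simp add: even)
    also have "\<dots> = Q z * (g z * g (- z))"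
      unfolding Q_eq by (subst (1 2) fg) (simp add: mult_ac)
    also have "g z * g (- z) = exp (G z)"
      using gL[of z] gL[of "- z"] that by (simp add: G_def exp_add)
    finally show ?thesis .
  qed
  \<comment> \<open>Second derivatives at the origin of both sides of \<open>f\<^sup>2 = exp G * Q\<close> determine that of \<open>G\<close>.\<close>
  have expG: "deriv (\<lambda>z. exp (G z)) 0 = 0" "(deriv ^^ 2) (\<lambda>z. exp (G z)) 0 = (deriv ^^ 2) G 0"
    using deriv2_exp_comp[OF G _ _ G0 dG] R by auto
  have "2 * (deriv ^^ 2) f 0 = (deriv ^^ 2) (\<lambda>z. f z * f z) 0"
    using deriv2_mult_normalized[OF f f] f0 df by simp
  also have "\<dots> = (deriv ^^ 2) (\<lambda>z. exp (G z) * Q z) 0"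
    by (rule higher_deriv_transform_within_open[of _ "ball 0 R"])
      (use R in \<open>auto intro!: holomorphic_intros G holomorphic_on_subset[OF f] holomorphic_on_subset[OF Q] simp: sq\<close>)
  also have "\<dots> = (deriv ^^ 2) G 0 - 2 * (\<Sum>a\<leftarrow>zs. 1 / a\<^sup>2)"
  proof -
    have "(deriv ^^ 2) (\<lambda>z. exp (G z) * Q z) 0 = (deriv ^^ 2) (\<lambda>z. exp (G z)) 0 + (deriv ^^ 2) Q 0"
      by (rule deriv2_mult_normalized[of _ "ball 0 R"])
        (use R G0 Q0 expG in \<open>auto intro!: holomorphic_intros G holomorphic_on_subset[OF Q]\<close>)
    also have "(deriv ^^ 2) Q 0 = - 2 * (\<Sum>a\<leftarrow>zs. 1 / a\<^sup>2)"
      unfolding Q_def by (rule deriv2_even_product)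
    finally show ?thesis by (simp add: expG)
  qed
  finally have ddG: "(deriv ^^ 2) G 0 = 2 * ((deriv ^^ 2) f 0 + (\<Sum>a\<leftarrow>zs. 1 / a\<^sup>2))"
    by (simp add: algebra_simps)
  have prod_exp: "(\<Prod>a\<leftarrow>zs. (1 - (z / a)\<^sup>2) * exp ((z / a)\<^sup>2)) = Q z * exp ((\<Sum>a\<leftarrow>zs. 1 / a\<^sup>2) * z\<^sup>2)" for z
    unfolding Q_def by (induction zs) (auto simp: algebra_simps exp_add power_divide)
  show thesis
  proof (rule that[OF zs])
    fix z :: complex assume z: "4 * norm z \<le> R"
    define e where "e = G z - (G 0 + deriv G 0 * z + (deriv ^^ 2) G 0 * z\<^sup>2 / 2)"
    have "norm e \<le> 24 * (2 * (11 * A * R\<^sup>2)) / (R / 2) ^ 3 * norm z ^ 3"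
      unfolding e_def
      by (rule Taylor_quadratic_remainder[OF G]) (use R z G_le in \<open>auto simp: subset_iff\<close>)
    \<comment> \<open>The constant is \<open>24 * (2 * 11) * 2 ^ 3\<close>.\<close>
    also have "\<dots> = 4224 * A * norm z ^ 3 / R"
      using R by (simp add: power_divide field_simps power2_eq_square power3_eq_cube)
    finally have "norm e \<le> 4224 * A * norm z ^ 3 / R" .
    moreover have "G z = ((\<Sum>a\<leftarrow>zs. 1 / a\<^sup>2) * z\<^sup>2) + ((deriv ^^ 2) f 0 * z\<^sup>2 + e)"
      by (simp add: e_def G0 dG ddG algebra_simps)
    then have "(f z)\<^sup>2 = (\<Prod>a\<leftarrow>zs. (1 - (z / a)\<^sup>2) * exp ((z / a)\<^sup>2)) * exp ((deriv ^^ 2) f 0 * z\<^sup>2 + e)"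
      using sq[of z] z R unfolding prod_exp by (simp add: power2_eq_square exp_add mult.assoc)
    ultimately show "\<exists>e. norm e \<le> 4224 * A * norm z ^ 3 / R \<and>
       (f z)\<^sup>2 = (\<Prod>a\<leftarrow>zs. (1 - (z / a)\<^sup>2) * exp ((z / a)\<^sup>2)) * exp ((deriv ^^ 2) f 0 * z\<^sup>2 + e)"
      by blast
  qed
qed

text \<open>
  Without zeros the product is empty for every \<open>R\<close>, and the error term vanishes in the limit.
\<close>
lemma zero_free_even_entire_square:
  fixes f :: "complex \<Rightarrow> complex"
  assumes f: "f holomorphic_on UNIV" and even: "\<And>z. f (- z) = f z" and f0: "f 0 = 1"
    and growth: "\<And>z. norm (f z) \<le> exp (A * (1 + (norm z)\<^sup>2))" and A: "A > 0"
    and nz: "\<And>z. f z \<noteq> 0"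
  shows "(f z)\<^sup>2 = exp ((deriv ^^ 2) f 0 * z\<^sup>2)"
proof -
  have "\<exists>e. norm e \<le> 4224 * A * norm z ^ 3 / R \<and> (f z)\<^sup>2 = exp ((deriv ^^ 2) f 0 * z\<^sup>2 + e)"
    if "R \<ge> 1" "4 * norm z \<le> R" for R
    using even_entire_quadratic_factorization[OF f even f0 growth A that(1)] that nz by fastforce
  then obtain e where e: "norm (e R) \<le> 4224 * A * norm z ^ 3 / R"
    "(f z)\<^sup>2 = exp ((deriv ^^ 2) f 0 * z\<^sup>2 + e R)" if "R \<ge> 1" "4 * norm z \<le> R" for R
    by metis
  have large: "eventually (\<lambda>R. R \<ge> 1 \<and> 4 * norm z \<le> R) at_top"
    by (intro eventually_conj eventually_ge_at_top)
  have "((\<lambda>R. 4224 * A * norm z ^ 3 / R) \<longlongrightarrow> 0) at_top"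
    by real_asymp
  then have "(e \<longlongrightarrow> 0) at_top"
    by (rule Lim_null_comparison[rotated]) (use large e(1) in \<open>auto elim: eventually_mono\<close>)
  then have "((\<lambda>R. exp ((deriv ^^ 2) f 0 * z\<^sup>2 + e R)) \<longlongrightarrow> exp ((deriv ^^ 2) f 0 * z\<^sup>2 + 0)) at_top"
    by (intro tendsto_intros)
  moreover have "((\<lambda>R. exp ((deriv ^^ 2) f 0 * z\<^sup>2 + e R)) \<longlongrightarrow> (f z)\<^sup>2) at_top"
    by (rule tendsto_eventually) (use large e(2) in \<open>auto elim: eventually_mono\<close>)
  ultimately show ?thesis using tendsto_unique[OF trivial_limit_at_top_linorder] by fastforce
qed

section \<open>Zeros in a sector and bounds on the imaginary axis\<close>

lemma norm_one_plus_sq_le: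
  fixes u :: complex
  assumes "\<bar>Im u\<bar> \<le> Re u"
  shows "(norm (1 + u))\<^sup>2 \<le> 1 + 2 * Re u + 2 * (Re u)\<^sup>2"
proof -
  have "(Im u)\<^sup>2 \<le> (Re u)\<^sup>2" using power_mono[OF assms, of 2] by simp
  then show ?thesis by (simp only: cmod_power2) (simp add: power2_eq_square algebra_simps)
qed

text \<open>
  In the sector \<open>\<bar>Im u\<bar> \<le> Re u\<close> the square of \<open>norm (1 + u)\<close> is at most
  \<open>1 + x + x\<^sup>2 / 2 \<le> exp x\<close> with \<open>x = 2 * Re u\<close>. The opening of the sector is exactly what makes the
  quadratic term fit.
\<close>
lemma norm_one_plus_exp_le_1:
  fixes u :: complex
  assumes "\<bar>Im u\<bar> \<le> Re u"
  shows "norm ((1 + u) * exp (- u)) \<le> 1"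
proof -
  have "(norm (1 + u))\<^sup>2 \<le> 1 + 2 * Re u + (2 * Re u)\<^sup>2 / 2"
    using norm_one_plus_sq_le[OF assms] by (simp add: power2_eq_square)
  also have "\<dots> \<le> exp (2 * Re u)"
    using assms by (intro exp_lower_Taylor_quadratic) auto
  also have "\<dots> = (exp (Re u))\<^sup>2" by (simp add: exp_double)
  finally have "norm (1 + u) \<le> exp (Re u)" by (rule power2_le_imp_le) auto
  then have "norm (1 + u) * exp (- Re u) \<le> exp (Re u) * exp (- Re u)"
    by (intro mult_right_mono) auto
  then show ?thesis by (simp add: norm_mult flip: exp_add)
qed

text \<open>
  The left-hand side is a partial sum of \<open>exp (2 * r)\<close>, so for \<open>r\<close> bounded away from \<open>0\<close> there is
  room to lower the exponent slightly. The cubic term of the exponential pays for this;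
  it is extracted from the square of the quadratic bound for \<open>exp (l * r)\<close>.
\<close>
lemma exp_gain:
  fixes r0 :: real
  assumes "r0 > 0"
  obtains \<delta> where "\<delta> > 0" "\<And>r. r \<ge> r0 \<Longrightarrow> 1 + 2 * r + 2 * r\<^sup>2 \<le> exp (2 * (1 - \<delta>) * r)"
proof -
  \<comment> \<open>With \<open>l = 1 - \<delta> \<ge> 1 / 2\<close> the cubic term \<open>(l * r) ^ 3\<close> is at least \<open>r ^ 3 / 8\<close>; the last two bounds on
      \<open>\<delta>\<close> let one half of it absorb the loss in the linear term and the other half the loss in the
      quadratic term.\<close>
  define \<delta> where "\<delta> = min (1 / 2) (min (r0\<^sup>2 / 32) (r0 / 64))"
  have \<delta>: "\<delta> > 0" "\<delta> \<le> 1 / 2" "\<delta> \<le> r0\<^sup>2 / 32" "\<delta> \<le> r0 / 64"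
    using assms by (auto simp: \<delta>_def)
  have "1 + 2 * r + 2 * r\<^sup>2 \<le> exp (2 * (1 - \<delta>) * r)" if r: "r \<ge> r0" for r
  proof -
    define l where "l = 1 - \<delta>"
    have l: "1 / 2 \<le> l" "l \<le> 1" using \<delta> by (auto simp: l_def)
    have "2 * \<delta> \<le> r\<^sup>2 / 16"
      using \<delta>(3) power_mono[OF r, of 2] assms by simp
    moreover have "4 * \<delta> * r \<le> r\<^sup>2 / 16"
      using \<delta>(4) r assms mult_right_mono[of "64 * \<delta>" r r] by (simp add: power2_eq_square)
    moreover have "(1 - l\<^sup>2) * r \<le> 2 * \<delta> * r"
    proof -
      have "0 \<le> \<delta> * \<delta>" by simp
      then have "1 - l\<^sup>2 \<le> 2 * \<delta>" by (simp add: l_def power2_eq_square algebra_simps)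
      then show ?thesis using r assms by (intro mult_right_mono) auto
    qed
    moreover have "r\<^sup>2 / 8 \<le> l ^ 3 * r\<^sup>2"
    proof -
      have "(1 / 2) ^ 3 \<le> l ^ 3" using l by (intro power_mono) auto
      then have "(1 / 2) ^ 3 * r\<^sup>2 \<le> l ^ 3 * r\<^sup>2" by (intro mult_right_mono) auto
      then show ?thesis by (simp add: power_divide)
    qed
    ultimately have "2 * \<delta> + 2 * ((1 - l\<^sup>2) * r) \<le> l ^ 3 * r\<^sup>2" by linarith
    then have "r * (2 * \<delta> + 2 * ((1 - l\<^sup>2) * r)) \<le> r * (l ^ 3 * r\<^sup>2)"
      using r assms by (intro mult_left_mono) auto
    moreover have "1 + 2 * (l * r) + 2 * (l * r)\<^sup>2 + (l * r) ^ 3 - (1 + 2 * r + 2 * r\<^sup>2)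
        = r * (l ^ 3 * r\<^sup>2) - r * (2 * \<delta> + 2 * ((1 - l\<^sup>2) * r))"
      unfolding l_def by algebra
    ultimately have "1 + 2 * r + 2 * r\<^sup>2 \<le> 1 + 2 * (l * r) + 2 * (l * r)\<^sup>2 + (l * r) ^ 3"
      by linarith
    also have "\<dots> \<le> (1 + l * r + (l * r)\<^sup>2 / 2)\<^sup>2"
    proof -
      have "(1 + y + y\<^sup>2 / 2)\<^sup>2 = 1 + 2 * y + 2 * y\<^sup>2 + y ^ 3 + (y\<^sup>2 / 2)\<^sup>2" for y :: real
        by (simp add: power2_eq_square power3_eq_cube field_simps)
      then show ?thesis by simp
    qed
    also have "\<dots> \<le> (exp (l * r))\<^sup>2"
      using l r assms by (intro power_mono exp_lower_Taylor_quadratic) auto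
    also have "\<dots> = exp (2 * (1 - \<delta>) * r)" by (simp only: l_def exp_double mult.assoc)
    finally show ?thesis .
  qed
  then show thesis using \<delta>(1) that by blast
qed

lemma norm_prod_list_le_1:
  fixes h :: "'a \<Rightarrow> complex"
  assumes "\<And>a. a \<in> set zs \<Longrightarrow> norm (h a) \<le> 1"
  shows "norm (\<Prod>a\<leftarrow>zs. h a) \<le> 1"
  using assms by (induction zs) (auto simp: norm_mult intro!: mult_le_one)

lemma norm_prod_list_le_factor:
  fixes h :: "'a \<Rightarrow> complex"
  assumes "\<And>a. a \<in> set zs \<Longrightarrow> norm (h a) \<le> 1" "b \<in> set zs"
  shows "norm (\<Prod>a\<leftarrow>zs. h a) \<le> norm (h b)"
proof -
  obtain ys ys' where zs: "zs = ys @ b # ys'" using assms(2) by (meson split_list)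
  have "norm (\<Prod>a\<leftarrow>zs. h a) = norm (\<Prod>a\<leftarrow>ys. h a) * norm (\<Prod>a\<leftarrow>ys'. h a) * norm (h b)"
    by (simp add: zs norm_mult)
  also have "\<dots> \<le> 1 * norm (h b)"
    using assms(1) zs by (intro mult_right_mono mult_le_one norm_prod_list_le_1) auto
  finally show ?thesis by simp
qed

text \<open>
  At \<open>z = \<i> t\<close> each factor \<open>(1 - (z / a)\<^sup>2) exp ((z / a)\<^sup>2)\<close> has the form \<open>(1 + u) exp (- u)\<close>
  with \<open>u = t\<^sup>2 / a\<^sup>2\<close> in the sector where its modulus is at most \<open>1\<close>. The first bound drops all
  factors, the second keeps the one belonging to a given zero; both survive the limit \<open>R \<rightarrow> \<infinity>\<close>
  because they do not depend on \<open>R\<close>.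
\<close>
lemma imaginary_axis_bound:
  fixes f :: "complex \<Rightarrow> complex"
  assumes f: "f holomorphic_on UNIV" and even: "\<And>z. f (- z) = f z" and f0: "f 0 = 1"
    and growth: "\<And>z. norm (f z) \<le> exp (A * (1 + (norm z)\<^sup>2))" and A: "A > 0"
    and zeros: "\<And>a. f a = 0 \<Longrightarrow> \<bar>Im (1 / a\<^sup>2)\<bar> \<le> Re (1 / a\<^sup>2)"
  shows "(norm (f (\<i> * of_real t)))\<^sup>2 \<le> exp (- Re ((deriv ^^ 2) f 0) * t\<^sup>2)"
    and "f b = 0 \<Longrightarrow> (norm (f (\<i> * of_real t)))\<^sup>2 \<le>
      norm ((1 + of_real (t\<^sup>2) / b\<^sup>2) * exp (- (of_real (t\<^sup>2) / b\<^sup>2))) * exp (- Re ((deriv ^^ 2) f 0) * t\<^sup>2)"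
proof -
  define h where "h a = (1 + complex_of_real (t\<^sup>2) / a\<^sup>2) * exp (- (of_real (t\<^sup>2) / a\<^sup>2))" for a
  define z where "z = \<i> * complex_of_real t"
  have norm_z: "norm z = \<bar>t\<bar>" by (simp add: z_def norm_mult)
  have z2: "z\<^sup>2 = - of_real (t\<^sup>2)" by (simp add: z_def power_mult_distrib)
  have h_le: "norm (h a) \<le> 1" if "f a = 0" for a
  proof -
    have "t\<^sup>2 * \<bar>Im (1 / a\<^sup>2)\<bar> \<le> t\<^sup>2 * Re (1 / a\<^sup>2)" using zeros[OF that] by (intro mult_left_mono) auto
    moreover have "complex_of_real (t\<^sup>2) / a\<^sup>2 = of_real (t\<^sup>2) * (1 / a\<^sup>2)" by simp
    then have "Im (complex_of_real (t\<^sup>2) / a\<^sup>2) = t\<^sup>2 * Im (1 / a\<^sup>2)" "Re (complex_of_real (t\<^sup>2) / a\<^sup>2) = t\<^sup>2 * Re (1 / a\<^sup>2)"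
      by (metis Im_complex_of_real Re_complex_of_real times_complex.simps mult_zero_left add_0_right diff_zero)+
    ultimately show ?thesis unfolding h_def
      by (intro norm_one_plus_exp_le_1) (simp add: abs_mult)
  qed
  have main: "(norm (f z))\<^sup>2 \<le> \<beta> * exp (- Re ((deriv ^^ 2) f 0) * t\<^sup>2)"
    if \<beta>: "\<And>R zs. R \<ge> R0 \<Longrightarrow> set zs = {a \<in> cball 0 R. f a = 0} \<Longrightarrow> norm (\<Prod>a\<leftarrow>zs. h a) \<le> \<beta>" for \<beta> R0
  proof (rule tendsto_lowerbound[OF _ _ trivial_limit_at_top_linorder])
    let ?q = "- Re ((deriv ^^ 2) f 0) * t\<^sup>2"
    have "((\<lambda>R. 4224 * A * norm z ^ 3 / R) \<longlongrightarrow> 0) at_top" by real_asymp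
    then have "((\<lambda>R. \<beta> * exp (?q + 4224 * A * norm z ^ 3 / R)) \<longlongrightarrow> \<beta> * exp (?q + 0)) at_top"
      by (intro tendsto_intros)
    then show "((\<lambda>R. \<beta> * exp (?q + 4224 * A * norm z ^ 3 / R)) \<longlongrightarrow> \<beta> * exp ?q) at_top" by simp
    show "eventually (\<lambda>R. (norm (f z))\<^sup>2 \<le> \<beta> * exp (?q + 4224 * A * norm z ^ 3 / R)) at_top"
      using eventually_ge_at_top[of R0] eventually_ge_at_top[of 1] eventually_ge_at_top[of "4 * norm z"]
    proof eventually_elim
      case (elim R)
      obtain zs where zs: "set zs = {a \<in> cball 0 R. f a = 0}"
        and *: "\<And>z. 4 * norm z \<le> R \<Longrightarrow> \<exists>e. norm e \<le> 4224 * A * norm z ^ 3 / R \<and>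
          (f z)\<^sup>2 = (\<Prod>a\<leftarrow>zs. (1 - (z / a)\<^sup>2) * exp ((z / a)\<^sup>2)) * exp ((deriv ^^ 2) f 0 * z\<^sup>2 + e)"
        using even_entire_quadratic_factorization[OF f even f0 growth A elim(2)] by blast
      obtain e where e: "norm e \<le> 4224 * A * norm z ^ 3 / R"
        and fz: "(f z)\<^sup>2 = (\<Prod>a\<leftarrow>zs. (1 - (z / a)\<^sup>2) * exp ((z / a)\<^sup>2)) * exp ((deriv ^^ 2) f 0 * z\<^sup>2 + e)"
        using *[OF elim(3)] by blast
      have "(norm (f z))\<^sup>2 = norm ((f z)\<^sup>2)" by (simp add: norm_power)
      also have "\<dots> = norm (\<Prod>a\<leftarrow>zs. h a) * exp (?q + Re e)"
        unfolding fz norm_mult by (simp add: h_def power_divide z2)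
      also have "\<dots> \<le> \<beta> * exp (?q + 4224 * A * norm z ^ 3 / R)"
      proof (rule mult_mono)
        show le: "norm (\<Prod>a\<leftarrow>zs. h a) \<le> \<beta>" using \<beta>[OF elim(1) zs] .
        show "exp (?q + Re e) \<le> exp (?q + 4224 * A * norm z ^ 3 / R)"
          using e complex_Re_le_cmod[of e] by simp
        show "0 \<le> \<beta>" using le norm_ge_zero order_trans by blast
      qed auto
      finally show ?case .
    qed
  qed
  show "(norm (f (\<i> * of_real t)))\<^sup>2 \<le> exp (- Re ((deriv ^^ 2) f 0) * t\<^sup>2)"
  proof -
    have "(norm (f z))\<^sup>2 \<le> 1 * exp (- Re ((deriv ^^ 2) f 0) * t\<^sup>2)"
      by (rule main[of 0]) (use h_le in \<open>auto intro!: norm_prod_list_le_1\<close>)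
    then show ?thesis by (simp add: z_def)
  qed
  show "(norm (f (\<i> * of_real t)))\<^sup>2 \<le>
      norm ((1 + of_real (t\<^sup>2) / b\<^sup>2) * exp (- (of_real (t\<^sup>2) / b\<^sup>2))) * exp (- Re ((deriv ^^ 2) f 0) * t\<^sup>2)"
    if b: "f b = 0"
  proof -
    have "(norm (f z))\<^sup>2 \<le> norm (h b) * exp (- Re ((deriv ^^ 2) f 0) * t\<^sup>2)"
      by (rule main[of "norm b"]) (use h_le b in \<open>auto intro!: norm_prod_list_le_factor\<close>)
    then show ?thesis by (simp add: h_def z_def)
  qed
qed

section \<open>The characteristic function of a subgaussian variable\<close>

text \<open>
  Completing the square, \<open>r \<bar>x\<bar> \<le> c x\<^sup>2 + r\<^sup>2 / (4 c)\<close>, so the Laplace transform of \<open>\<bar>X\<bar>\<close> grows at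
  most like \<open>exp (r\<^sup>2 / (4 c))\<close>. The form \<open>exp (A * (1 + r\<^sup>2))\<close> is the growth condition used for entire functions
  above.
\<close>
lemma subgaussian_exp_abs_moment:
  assumes "prob_space M" and X: "X \<in> borel_measurable M" and sub: "subgaussian M X"
  obtains A where "A > 0" "\<And>r. integrable M (\<lambda>\<omega>. exp (r * \<bar>X \<omega>\<bar>))"
    "\<And>r. (\<integral>\<omega>. exp (r * \<bar>X \<omega>\<bar>) \<partial>M) \<le> exp (A * (1 + r\<^sup>2))"
proof -
  interpret prob_space M by fact
  obtain c where c: "c > 0" and int: "integrable M (\<lambda>\<omega>. exp (c * (X \<omega>)\<^sup>2))"
    using sub by (auto simp: subgaussian_def)
  define C where "C = (\<integral>\<omega>. exp (c * (X \<omega>)\<^sup>2) \<partial>M)"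
  have "(\<integral>\<omega>. 1 \<partial>M) \<le> C"
    unfolding C_def using c by (intro integral_mono int) auto
  then have C: "C \<ge> 1" by (simp add: prob_space)
  have le: "exp (r * \<bar>x\<bar>) \<le> exp (r\<^sup>2 / (4 * c)) * exp (c * x\<^sup>2)" for r x :: real
  proof -
    have "0 \<le> (2 * c * \<bar>x\<bar> - r)\<^sup>2 / (4 * c)" using c by simp
    also have "\<dots> = r\<^sup>2 / (4 * c) + c * x\<^sup>2 - r * \<bar>x\<bar>"
      using c by (simp add: power2_eq_square field_simps)
    finally show ?thesis by (simp flip: exp_add)
  qed
  have int': "integrable M (\<lambda>\<omega>. exp (r * \<bar>X \<omega>\<bar>))" for r
    by (rule Bochner_Integration.integrable_bound[OF integrable_mult_right[OF int, of "exp (r\<^sup>2 / (4 * c))"]])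
      (use X le in auto)
  define A where "A = ln C + 1 / (4 * c)"
  have "A > 0" using C c by (simp add: A_def add_nonneg_pos)
  moreover have "(\<integral>\<omega>. exp (r * \<bar>X \<omega>\<bar>) \<partial>M) \<le> exp (A * (1 + r\<^sup>2))" for r
  proof -
    have "(\<integral>\<omega>. exp (r * \<bar>X \<omega>\<bar>) \<partial>M) \<le> (\<integral>\<omega>. exp (r\<^sup>2 / (4 * c)) * exp (c * (X \<omega>)\<^sup>2) \<partial>M)"
      using le by (intro integral_mono int' integrable_mult_right int)
    also have "\<dots> = exp (r\<^sup>2 / (4 * c) + ln C)"
      using C by (simp add: C_def[symmetric] exp_add)
    also have "\<dots> \<le> exp (A * (1 + r\<^sup>2))"
    proof -
      have "A * (1 + r\<^sup>2) = (r\<^sup>2 / (4 * c) + ln C) + (ln C * r\<^sup>2 + 1 / (4 * c))"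
        by (simp add: A_def algebra_simps add_divide_distrib)
      moreover have "0 \<le> ln C * r\<^sup>2 + 1 / (4 * c)"
        using C c by (intro add_nonneg_nonneg mult_nonneg_nonneg) auto
      ultimately show ?thesis by (simp only: exp_le_cancel_iff)
    qed
    finally show ?thesis .
  qed
  ultimately show thesis using that int' by blast
qed

lemma complex_char_growth:
  assumes "integrable M (\<lambda>\<omega>. exp (norm z * \<bar>X \<omega>\<bar>))" and X: "X \<in> borel_measurable M"
  shows "norm (complex_char M X z) \<le> (\<integral>\<omega>. exp (norm z * \<bar>X \<omega>\<bar>) \<partial>M)"
proof -
  have le: "norm (exp (\<i> * z * complex_of_real x)) \<le> exp (norm z * \<bar>x\<bar>)" for x
  proof -
    have "Re (\<i> * z * complex_of_real x) \<le> norm (\<i> * z * complex_of_real x)" by (rule complex_Re_le_cmod)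
    then show ?thesis by (simp add: norm_mult)
  qed
  have int: "integrable M (\<lambda>\<omega>. exp (\<i> * z * complex_of_real (X \<omega>)))"
    by (rule Bochner_Integration.integrable_bound[OF assms(1)]) (use X le in auto)
  show "norm (complex_char M X z) \<le> (\<integral>\<omega>. exp (norm z * \<bar>X \<omega>\<bar>) \<partial>M)"
    unfolding complex_char_def
    by (rule order_trans[OF integral_norm_bound]) (intro integral_mono integrable_norm int assms(1) le)
qed

lemma power_div_fact_le_exp:
  fixes x :: real
  assumes "x \<ge> 0"
  shows "x ^ n / fact n \<le> exp x"
proof -
  have "(\<Sum>i\<in>{n}. x ^ i /\<^sub>R fact i) \<le> (\<Sum>i. x ^ i /\<^sub>R fact i)"
    using assms by (intro sum_le_suminf summable_exp_generic) auto
  then show ?thesis by (simp add: exp_def divide_inverse mult.commute)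
qed

text \<open>
  Term-by-term integration of the exponential series, dominated by \<open>exp (norm z * \<bar>X\<bar>)\<close>.
\<close>
lemma complex_char_power_series:
  assumes exp_int: "\<And>r. integrable M (\<lambda>\<omega>. exp (r * \<bar>X \<omega>\<bar>))" and X: "X \<in> borel_measurable M"
  shows "(\<lambda>n. (\<i> ^ n * of_real (\<integral>\<omega>. X \<omega> ^ n \<partial>M) / fact n) * z ^ n) sums complex_char M X z"
proof -
  define u where "u n \<omega> = (\<i> * z * complex_of_real (X \<omega>)) ^ n /\<^sub>R fact n" for n \<omega>
  have norm_u: "norm (u n \<omega>) = (norm z * \<bar>X \<omega>\<bar>) ^ n /\<^sub>R fact n" for n \<omega>
    by (simp add: u_def norm_power norm_mult)
  have u_int: "integrable M (u n)" for n
  proof (rule Bochner_Integration.integrable_bound[OF exp_int[of "norm z"]])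
    show "u n \<in> borel_measurable M" unfolding u_def using X by measurable
    show "AE \<omega> in M. norm (u n \<omega>) \<le> norm (exp (norm z * \<bar>X \<omega>\<bar>))"
      using power_div_fact_le_exp[of "norm z * \<bar>X _\<bar>" n] by (simp add: norm_u divide_inverse mult.commute)
  qed
  have "(\<lambda>n. integral\<^sup>L M (u n)) sums (\<integral>\<omega>. (\<Sum>n. u n \<omega>) \<partial>M)"
  proof (rule sums_integral[OF u_int])
    show "AE \<omega> in M. summable (\<lambda>n. norm (u n \<omega>))"
      unfolding norm_u by (intro always_eventually allI summable_exp_generic)
    show "summable (\<lambda>n. \<integral>\<omega>. norm (u n \<omega>) \<partial>M)"
    proof (rule summableI_nonneg_bounded)
      fix N
      have "(\<Sum>n<N. \<integral>\<omega>. norm (u n \<omega>) \<partial>M) = (\<integral>\<omega>. (\<Sum>n<N. norm (u n \<omega>)) \<partial>M)"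
        using u_int by (subst Bochner_Integration.integral_sum) auto
      also have "\<dots> \<le> (\<integral>\<omega>. exp (norm z * \<bar>X \<omega>\<bar>) \<partial>M)"
      proof (rule integral_mono)
        fix \<omega>
        show "(\<Sum>n<N. norm (u n \<omega>)) \<le> exp (norm z * \<bar>X \<omega>\<bar>)"
          unfolding norm_u exp_def by (intro sum_le_suminf summable_exp_generic) auto
      qed (use u_int exp_int in auto)
      finally show "(\<Sum>n<N. \<integral>\<omega>. norm (u n \<omega>) \<partial>M) \<le> (\<integral>\<omega>. exp (norm z * \<bar>X \<omega>\<bar>) \<partial>M)" .
    qed auto
  qed
  moreover have "(\<integral>\<omega>. (\<Sum>n. u n \<omega>) \<partial>M) = complex_char M X z"
    unfolding complex_char_def u_def by (simp add: exp_def)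
  moreover have "integral\<^sup>L M (u n) = (\<i> ^ n * of_real (\<integral>\<omega>. X \<omega> ^ n \<partial>M) / fact n) * z ^ n" for n
  proof -
    have "u n = (\<lambda>\<omega>. (\<i> ^ n * z ^ n / fact n) * complex_of_real (X \<omega> ^ n))"
      by (auto simp: u_def power_mult_distrib scaleR_conv_of_real divide_inverse)
    then show ?thesis by (simp only: integral_mult_right_zero integral_complex_of_real) simp
  qed
  ultimately show ?thesis by simp
qed

lemma complex_char_entire:
  assumes exp_int: "\<And>r. integrable M (\<lambda>\<omega>. exp (r * \<bar>X \<omega>\<bar>))" and X: "X \<in> borel_measurable M"
  shows "complex_char M X holomorphic_on UNIV"
    and "(deriv ^^ 2) (complex_char M X) 0 = - of_real (\<integral>\<omega>. (X \<omega>)\<^sup>2 \<partial>M)"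
proof -
  define a where "a n = \<i> ^ n * of_real (\<integral>\<omega>. X \<omega> ^ n \<partial>M) / fact n" for n
  have sums: "(\<lambda>n. a n * z ^ n) sums complex_char M X z" for z
    unfolding a_def by (rule complex_char_power_series[OF assms])
  have "complex_char M X holomorphic_on ball 0 r" for r
    by (rule power_series_holomorphic[of _ _ a]) (use sums in auto)
  then have "complex_char M X holomorphic_on (\<Union>r. ball 0 r)"
    by (intro holomorphic_on_UN_open) auto
  moreover have "(\<Union>r. ball (0::complex) r) = UNIV" by (auto intro: gt_ex)
  ultimately show "complex_char M X holomorphic_on UNIV" by simp
  have "complex_char M X has_fps_expansion Abs_fps a"
    by (rule has_fps_expansionI) (use sums in auto)
  then have "fps_nth (Abs_fps a) 2 = (deriv ^^ 2) (complex_char M X) 0 / fact 2"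
    by (rule fps_nth_fps_expansion)
  then show "(deriv ^^ 2) (complex_char M X) 0 = - of_real (\<integral>\<omega>. (X \<omega>)\<^sup>2 \<partial>M)"
    by (simp add: a_def)
qed

lemma symmetric_distribution_integral:
  fixes h :: "real \<Rightarrow> 'b :: {banach, second_countable_topology}"
  assumes "symmetric_distribution M X" "X \<in> borel_measurable M" "h \<in> borel_measurable borel"
  shows "(\<integral>\<omega>. h (- X \<omega>) \<partial>M) = (\<integral>\<omega>. h (X \<omega>) \<partial>M)"
proof -
  have "(\<integral>\<omega>. h (- X \<omega>) \<partial>M) = (\<integral>x. h x \<partial>distr M borel (\<lambda>\<omega>. - X \<omega>))"
    using assms by (subst integral_distr) auto
  also have "\<dots> = (\<integral>\<omega>. h (X \<omega>) \<partial>M)"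
    unfolding assms(1)[unfolded symmetric_distribution_def, symmetric]
    using assms by (subst integral_distr) auto
  finally show ?thesis .
qed

lemma complex_char_even:
  assumes "symmetric_distribution M X" "X \<in> borel_measurable M"
  shows "complex_char M X (- z) = complex_char M X z"
  using symmetric_distribution_integral[OF assms, of "\<lambda>x. exp (\<i> * z * complex_of_real x)"]
  by (simp add: complex_char_def)

lemma complex_char_imaginary:
  "complex_char M X (- (\<i> * of_real t)) = of_real (\<integral>\<omega>. exp (t * X \<omega>) \<partial>M)"
proof -
  have "exp (\<i> * (- (\<i> * of_real t)) * complex_of_real x) = complex_of_real (exp (t * x))" for x
    by (simp add: exp_of_real[symmetric])
  then show ?thesis by (simp add: complex_char_def)
qed

lemma symmetric_variance:
  assumes "symmetric_distribution M X" "X \<in> borel_measurable M"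
  shows "prob_space.variance M X = (\<integral>\<omega>. (X \<omega>)\<^sup>2 \<partial>M)"
  using symmetric_distribution_integral[OF assms, of "\<lambda>x. x"] by simp

text \<open>
  Squaring doubles the half-angle \<open>pi / 8\<close> to \<open>pi / 4\<close>, where sine and cosine agree. The square
  identifies \<open>a\<close> with \<open>- a\<close>, which is why a condition on the right half-plane suffices for the
  zeros of an even function.
\<close>
lemma angle_imp_Re_inverse_square:
  fixes a :: complex
  assumes "Re a \<ge> 0 \<Longrightarrow> \<bar>Arg a\<bar> \<le> pi / 8" and "Re a \<le> 0 \<Longrightarrow> \<bar>Arg (- a)\<bar> \<le> pi / 8"
  shows "\<bar>Im (1 / a\<^sup>2)\<bar> \<le> Re (1 / a\<^sup>2)"
proof -
  have right: "\<bar>Im (1 / b\<^sup>2)\<bar> \<le> Re (1 / b\<^sup>2)" if "\<bar>Arg b\<bar> \<le> pi / 8" for b :: complex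
  proof -
    define \<theta> where "\<theta> = \<bar>2 * Arg b\<bar>"
    have \<theta>: "0 \<le> \<theta>" "\<theta> \<le> pi / 4" using that by (auto simp: \<theta>_def)
    have "sin \<theta> \<le> sin (pi / 4)" using \<theta> by (intro sin_monotone_2pi_le) auto
    also have "\<dots> = cos (pi / 4)" by (simp add: sin_45 cos_45)
    also have "\<dots> \<le> cos \<theta>" using \<theta> by (intro cos_monotone_0_pi_le) auto
    finally have "sin \<theta> \<le> cos \<theta>" .
    moreover have "sin \<theta> \<ge> 0" using \<theta> by (intro sin_ge_zero) auto
    moreover have "sin \<theta> = sin (2 * Arg b) \<or> sin \<theta> = - sin (2 * Arg b)"
      by (auto simp: \<theta>_def abs_if)
    moreover have "cos \<theta> = cos (2 * Arg b)" by (auto simp: \<theta>_def abs_if)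
    ultimately have "\<bar>sin (2 * Arg b)\<bar> \<le> cos (2 * Arg b)" by linarith
    then have le: "(1 / norm b)\<^sup>2 * \<bar>sin (2 * Arg b)\<bar> \<le> (1 / norm b)\<^sup>2 * cos (2 * Arg b)"
      by (intro mult_left_mono) auto
    have cis2: "(cis (Arg b))\<^sup>2 = cis (2 * Arg b)"
      by (simp only: Complex.DeMoivre) simp
    have "b = of_real (norm b) * cis (Arg b)"
      using rcis_cmod_Arg[of b] by (simp add: rcis_def)
    then have "1 / b\<^sup>2 = 1 / (of_real (norm b) * cis (Arg b))\<^sup>2" by (rule arg_cong)
    also have "\<dots> = of_real ((1 / norm b)\<^sup>2) * inverse (cis (2 * Arg b))"
      by (simp add: power_mult_distrib cis2 power_inverse divide_inverse)
    finally have "1 / b\<^sup>2 = of_real ((1 / norm b)\<^sup>2) * cis (- (2 * Arg b))"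
      by (simp only: cis_inverse)
    then show ?thesis using le by (simp add: abs_mult)
  qed
  show ?thesis
    using right[of a] right[of "- a"] assms by (cases "Re a \<ge> 0") auto
qed

section \<open>Recognising the normal distribution\<close>

text \<open>
  Levy's uniqueness theorem, applied to \<open>X / sqrt v\<close> and the standard normal distribution.
\<close>
lemma gaussian_char_imp_normal:
  assumes "prob_space M" and X: "X \<in> borel_measurable M" and v: "v > 0"
    and char: "\<And>t. complex_char M X (of_real t) = exp (- (of_real v * (of_real t)\<^sup>2 / 2))"
  shows "normal_rv M X"
proof -
  interpret prob_space M by fact
  define s where "s = sqrt v"
  have s: "s > 0" "s\<^sup>2 = v" using v by (auto simp: s_def)
  define Y where "Y \<omega> = (X \<omega> - 0) / s" for \<omega>
  have Y: "Y \<in> borel_measurable M" unfolding Y_def using X by measurable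
  have "char (distr M borel Y) = char std_normal_distribution"
  proof
    fix t
    have "char (distr M borel Y) t = (CLINT \<omega>|M. exp (\<i> * of_real (t * Y \<omega>)))"
      unfolding char_def using Y by (subst integral_distr) auto
    also have "\<dots> = complex_char M X (of_real (t / s))"
      by (simp add: complex_char_def Y_def mult.assoc)
    also have "\<dots> = of_real (exp (- (v * (t / s)\<^sup>2 / 2)))"
      unfolding char by (simp add: exp_of_real[symmetric])
    also have "\<dots> = char std_normal_distribution t"
      using s v by (simp add: char_std_normal_distribution power_divide)
    finally show "char (distr M borel Y) t = char std_normal_distribution t" .
  qed
  then have eq: "distr M borel Y = std_normal_distribution"
    by (intro Levy_uniqueness real_dist_normal_dist)
      (use Y in \<open>auto simp: real_distribution_def real_distribution_axioms_def intro!: prob_space_distr\<close>)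
  have "distr M lborel Y = distr M borel Y" by (rule distr_cong) auto
  then have "distributed M lborel Y (\<lambda>x. ennreal (std_normal_density x))"
    using Y eq by (simp add: distributed_def)
  then have "distributed M lborel X (\<lambda>x. ennreal (normal_density 0 s x))"
    unfolding normal_standard_normal_convert[OF s(1)] Y_def .
  then show ?thesis using s by (auto simp: normal_rv_def)
qed

lemma zero_second_moment_imp_normal:
  assumes "prob_space M" and X: "X \<in> borel_measurable M"
    and int: "integrable M (\<lambda>\<omega>. (X \<omega>)\<^sup>2)" and zero: "(\<integral>\<omega>. (X \<omega>)\<^sup>2 \<partial>M) = 0"
  shows "normal_rv M X"
proof -
  interpret prob_space M by fact
  have "AE \<omega> in M. (X \<omega>)\<^sup>2 = 0"
    using integral_nonneg_eq_0_iff_AE[OF int] zero by simp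
  then have "AE \<omega> in M. X \<omega> = 0" by simp
  then have "distr M borel X = distr M borel (\<lambda>_. 0)"
    using X by (intro distr_cong_AE) auto
  also have "\<dots> = return borel 0" by (rule distr_const) auto
  finally show ?thesis by (simp add: normal_rv_def)
qed

text \<open>
  The quotient of the two sides takes only the values \<open>1\<close> and \<open>-1\<close>, hence is constant by
  continuity.
\<close>
lemma square_eq_gaussian_imp_eq:
  fixes f :: "complex \<Rightarrow> complex"
  assumes f: "continuous_on UNIV f" and f0: "f 0 = 1"
    and sq: "\<And>z. (f z)\<^sup>2 = exp (- (of_real v * z\<^sup>2))"
  shows "f z = exp (- (of_real v * z\<^sup>2 / 2))"
proof -
  define h where "h z = f z * exp (of_real v * z\<^sup>2 / 2)" for z
  have "(h z)\<^sup>2 = 1" for z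
    by (simp add: h_def power_mult_distrib sq flip: exp_double exp_add)
  then have "h z \<in> {1, - 1}" for z by (simp add: power2_eq_1_iff)
  then have "range h \<subseteq> {1, - 1}" by blast
  then have "finite (range h)" by (rule finite_subset) simp
  moreover have "continuous_on UNIV h" unfolding h_def by (intro continuous_intros f) auto
  ultimately have "h constant_on UNIV"
    by (intro continuous_finite_range_constant) auto
  then have "h z = h 0" by (metis UNIV_I constant_on_def)
  then have "h z = 1" by (simp add: h_def f0)
  then show ?thesis by (simp add: h_def exp_minus field_simps)
qed

section \<open>Strict subgaussianity\<close>

theorem theorem8p1:
  fixes M :: "'a measure" and X :: "'a \<Rightarrow> real"
  assumes "prob_space M"
    and "X \<in> borel_measurable M"
    and "subgaussian M X"
    and "symmetric_distribution M X"
    and "\<And>z :: complex. complex_char M X z = 0 \<Longrightarrow> Re z \<ge> 0 \<Longrightarrow> \<bar>Arg z\<bar> \<le> pi / 8"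
  shows "strictly_subgaussian M X \<and>
    (\<not> normal_rv M X \<longrightarrow>
      (\<forall>t0>0. \<exists>c. 0 < c \<and> c < prob_space.variance M X \<and>
        (\<forall>t. \<bar>t\<bar> \<ge> t0 \<longrightarrow>
          prob_space.expectation M (\<lambda>\<omega>. exp (t * X \<omega>)) \<le> exp (c * t\<^sup>2 / 2))))"
proof -
  interpret prob_space M by fact
  note X = assms(2)
  define f where "f = complex_char M X"
  define v where "v = (\<integral>\<omega>. (X \<omega>)\<^sup>2 \<partial>M)"
  define m where "m t = (\<integral>\<omega>. exp (t * X \<omega>) \<partial>M)" for t
  have var: "variance X = v" unfolding v_def using assms by (intro symmetric_variance) auto
  obtain A where A: "A > 0" and exp_int: "\<And>r. integrable M (\<lambda>\<omega>. exp (r * \<bar>X \<omega>\<bar>))"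
    and exp_le: "\<And>r. (\<integral>\<omega>. exp (r * \<bar>X \<omega>\<bar>) \<partial>M) \<le> exp (A * (1 + r\<^sup>2))"
    using subgaussian_exp_abs_moment[OF assms(1,2,3)] by blast
  have f: "f holomorphic_on UNIV" and f2: "(deriv ^^ 2) f 0 = - of_real v"
    unfolding f_def v_def using complex_char_entire[OF exp_int X] by auto
  have even: "f (- z) = f z" for z unfolding f_def using assms by (intro complex_char_even) auto
  have f0: "f 0 = 1" by (simp add: f_def complex_char_def prob_space)
  have growth: "norm (f z) \<le> exp (A * (1 + (norm z)\<^sup>2))" for z
    unfolding f_def using complex_char_growth[OF exp_int X] exp_le order_trans by blast
  have zeros: "\<bar>Im (1 / a\<^sup>2)\<bar> \<le> Re (1 / a\<^sup>2)" if "f a = 0" for a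
    using that even[of a] assms(5)[of a] assms(5)[of "- a"]
    by (intro angle_imp_Re_inverse_square) (auto simp: f_def)
  have fm: "f (\<i> * of_real t) = of_real (m t)" for t
    using complex_char_imaginary[of M X t] even[of "\<i> * of_real t"] by (simp add: f_def m_def)
  have m_nonneg: "m t \<ge> 0" for t by (simp add: m_def)
  have m_int: "integrable M (\<lambda>\<omega>. exp (t * X \<omega>))" for t
  proof (rule Bochner_Integration.integrable_bound[OF exp_int[of "\<bar>t\<bar>"]])
    have "t * x \<le> \<bar>t\<bar> * \<bar>x\<bar>" for x by (metis abs_ge_self abs_mult)
    then show "AE \<omega> in M. norm (exp (t * X \<omega>)) \<le> norm (exp (\<bar>t\<bar> * \<bar>X \<omega>\<bar>))" by simp
  qed (use X in measurable)
  have from_square: "m t \<le> exp (c * t\<^sup>2 / 2)" if "(m t)\<^sup>2 \<le> exp (c * t\<^sup>2)" for t c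
  proof (rule power2_le_imp_le)
    show "(m t)\<^sup>2 \<le> (exp (c * t\<^sup>2 / 2))\<^sup>2" using that by (simp flip: exp_double)
  qed auto
  have "m t \<le> exp (v * t\<^sup>2 / 2)" for t
    using imaginary_axis_bound(1)[OF f even f0 growth A zeros, of t]
    by (intro from_square) (simp add: fm f2)
  then have "strictly_subgaussian M X"
    unfolding strictly_subgaussian_def var using m_int by (simp add: m_def)
  moreover have "\<exists>c. 0 < c \<and> c < v \<and> (\<forall>t. \<bar>t\<bar> \<ge> t0 \<longrightarrow> m t \<le> exp (c * t\<^sup>2 / 2))"
    if not_normal: "\<not> normal_rv M X" and t0: "t0 > 0" for t0
  proof -
    have X2_int: "integrable M (\<lambda>\<omega>. (X \<omega>)\<^sup>2)"
    proof (rule Bochner_Integration.integrable_bound[OF integrable_mult_right[OF exp_int[of 1], of 2]])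
      show "AE \<omega> in M. norm ((X \<omega>)\<^sup>2) \<le> norm (2 * exp (1 * \<bar>X \<omega>\<bar>))"
        using power_div_fact_le_exp[of "\<bar>X _\<bar>" 2] by (intro always_eventually allI) (simp add: mult.commute)
    qed (use X in measurable)
    have "v \<noteq> 0"
      using zero_second_moment_imp_normal[OF assms(1,2) X2_int] not_normal by (auto simp: v_def)
    moreover have "v \<ge> 0" by (simp add: v_def)
    ultimately have v: "v > 0" by simp
    \<comment> \<open>Otherwise \<open>f\<^sup>2\<close>, hence \<open>f\<close>, is Gaussian.\<close>
    have "\<exists>b. f b = 0"
    proof (rule ccontr)
      assume "\<not> ?thesis"
      then have "(f z)\<^sup>2 = exp (- (of_real v * z\<^sup>2))" for z
        using zero_free_even_entire_square[OF f even f0 growth A, of z] by (simp add: f2)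
      then have "f z = exp (- (of_real v * z\<^sup>2 / 2))" for z
        using f f0 holomorphic_on_imp_continuous_on by (intro square_eq_gaussian_imp_eq) auto
      then have "normal_rv M X"
        by (intro gaussian_char_imp_normal[OF assms(1,2) v]) (simp add: f_def)
      with not_normal show False by simp
    qed
    then obtain b where b: "f b = 0" by blast
    define u where "u = 1 / b\<^sup>2"
    have "u \<noteq> 0" using b f0 by (auto simp: u_def)
    then have Re_u: "Re u > 0" using zeros[OF b] by (auto simp: u_def[symmetric] complex_eq_iff)
    obtain \<delta> where \<delta>: "\<delta> > 0"
      and gain: "\<And>r. r \<ge> t0\<^sup>2 * Re u \<Longrightarrow> 1 + 2 * r + 2 * r\<^sup>2 \<le> exp (2 * (1 - \<delta>) * r)"
      using exp_gain[of "t0\<^sup>2 * Re u"] Re_u t0 by auto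
    \<comment> \<open>The maximum with \<open>v / 2\<close> only serves to keep \<open>c\<close> positive.\<close>
    define c where "c = max (v - \<delta> * Re u) (v / 2)"
    have "m t \<le> exp (c * t\<^sup>2 / 2)" if t: "\<bar>t\<bar> \<ge> t0" for t
    proof (rule from_square)
      define w where "w = of_real (t\<^sup>2) * u"
      have Re_w: "Re w = t\<^sup>2 * Re u" and Im_w: "Im w = t\<^sup>2 * Im u" by (simp_all add: w_def)
      have "\<bar>Im w\<bar> \<le> Re w"
        unfolding Re_w Im_w abs_mult using zeros[OF b] by (simp add: u_def mult_left_mono)
      then have "(norm (1 + w))\<^sup>2 \<le> 1 + 2 * Re w + 2 * (Re w)\<^sup>2"
        by (rule norm_one_plus_sq_le)
      also have "\<dots> \<le> exp (2 * (1 - \<delta>) * Re w)"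
      proof (rule gain)
        have "t0\<^sup>2 \<le> t\<^sup>2" using t t0 by (metis abs_le_square_iff abs_of_pos)
        then show "t0\<^sup>2 * Re u \<le> Re w" using Re_u by (simp add: Re_w)
      qed
      also have "\<dots> = (exp ((1 - \<delta>) * Re w))\<^sup>2" by (simp add: mult.assoc flip: exp_double)
      finally have "norm (1 + w) \<le> exp ((1 - \<delta>) * Re w)" by (rule power2_le_imp_le) auto
      then have "norm ((1 + w) * exp (- w)) \<le> exp ((1 - \<delta>) * Re w) * exp (- Re w)"
        by (simp add: norm_mult)
      also have "\<dots> = exp (- \<delta> * Re w)" by (simp add: algebra_simps flip: exp_add)
      finally have w_le: "norm ((1 + w) * exp (- w)) \<le> exp (- \<delta> * Re w)" .
      have "(m t)\<^sup>2 \<le> norm ((1 + w) * exp (- w)) * exp (v * t\<^sup>2)"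
        using imaginary_axis_bound(2)[OF f even f0 growth A zeros b, of t]
        by (simp add: fm f2 w_def u_def)
      also have "\<dots> \<le> exp (- \<delta> * Re w) * exp (v * t\<^sup>2)"
        using w_le by (intro mult_right_mono) auto
      also have "\<dots> = exp ((v - \<delta> * Re u) * t\<^sup>2)"
        by (simp add: Re_w algebra_simps flip: exp_add)
      also have "\<dots> \<le> exp (c * t\<^sup>2)"
        unfolding exp_le_cancel_iff by (intro mult_right_mono) (auto simp: c_def)
      finally show "(m t)\<^sup>2 \<le> exp (c * t\<^sup>2)" .
    qed
    moreover have "0 < c" "c < v" using v \<delta> Re_u by (auto simp: c_def)
    ultimately show ?thesis by blast
  qed
  ultimately show ?thesis unfolding var m_def by blast
qed

end
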